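(* Let $k\ge 2$ be an integer and let $\lambda_k$ be the unique positive root of $(k-1)\lambda^k+(2k+2)\lambda-k-1=0$ (it lies in $(0,1/2)$). If $\lambda_k\le\lambda<1/2$, then $$\{x^k y : x,y\in C_\lambda\}=[0,1],$$ where $C_\lambda=\{(1-\lambda)\sum_{i=1}^\infty d_i\lambda^{i-1} : d_i\in\{0,1\}\}$. Moreover, the sequence $(\lambda_k)_{k\ge2}$ is increasing and converges to $1/2$ as $k\to\infty$.
   Context: For $\lambda\in(0,1/2)$, $C_\lambda$ is the middle Cantor set with convex hull $[0,1]$, i.e. the unique nonempty compact set with $C_\lambda=\varphi_0(C_\lambda)\cup\varphi_1(C_\lambda)$, $\varphi_i(x)=\lambda x+i(1-\lambda)$. *)

theory Defs
  imports "HOL-Analysis.Analysis"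
begin

text \<open>Digits are indexed from 0 here, so the series is
  \<open>(1 - lam) * (d 0 + d 1 * lam + d 2 * lam\<^sup>2 + \<dots>)\<close>; it converges for \<open>0 < lam < 1/2\<close>,
  the range in which the definition is used.\<close>

definition cantor_set :: "real \<Rightarrow> real set" where
  "cantor_set lam = {(1 - lam) * (\<Sum>i. d i * lam ^ i) | d :: nat \<Rightarrow> real. \<forall>i. d i \<in> {0, 1}}"

definition is_lambda_root :: "nat \<Rightarrow> real \<Rightarrow> bool" where
  "is_lambda_root k x \<longleftrightarrow>
     x > 0 \<and> (real k - 1) * x ^ k + (2 * real k + 2) * x - real k - 1 = 0"

definition lambda_root :: "nat \<Rightarrow> real" where
  "lambda_root k = (THE x. is_lambda_root k x)"

definition cantor_map :: "real \<Rightarrow> real \<Rightarrow> real \<Rightarrow> real" where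
  "cantor_map lam i x = lam * x + i * (1 - lam)"

lemma summable_digits:
  fixes lam :: real and d :: "nat \<Rightarrow> real"
  assumes "0 < lam" "lam < 1/2" "\<forall>i. d i \<in> {0, 1}"
  shows "summable (\<lambda>i. d i * lam ^ i)"
proof (rule summable_comparison_test')
  show "summable (\<lambda>i. lam ^ i)" using assms by (intro summable_geometric) auto
  show "norm (d n * lam ^ n) \<le> lam ^ n" for n
    using assms(1) assms(3)[rule_format, of n] by auto
qed

lemma cantor_set_self_similar:
  assumes "0 < lam" "lam < 1/2"
  shows "cantor_set lam = cantor_map lam 0 ` cantor_set lam \<union> cantor_map lam 1 ` cantor_set lam"
    (is "?C = ?R")
proof
  show "?C \<subseteq> ?R"
  proof
    fix x assume "x \<in> ?C"
    then obtain d where d: "\<forall>i. d i \<in> {0, 1::real}" and x: "x = (1 - lam) * (\<Sum>i. d i * lam ^ i)"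
      unfolding cantor_set_def by blast
    define y where "y = (1 - lam) * (\<Sum>i. d (Suc i) * lam ^ i)"
    have y: "y \<in> ?C" unfolding y_def cantor_set_def
      using d by (intro CollectI exI[of _ "\<lambda>i. d (Suc i)"]) auto
    have s: "summable (\<lambda>i. d (Suc i) * lam ^ i)"
      using d by (intro summable_digits assms) auto
    have "(\<Sum>i. d i * lam ^ i) = d 0 + (\<Sum>i. lam * (d (Suc i) * lam ^ i))"
      using suminf_split_head[OF summable_digits[OF assms d]] by (simp add: mult_ac)
    also have "\<dots> = d 0 + lam * (\<Sum>i. d (Suc i) * lam ^ i)"
      using suminf_mult[OF s] by simp
    finally have "x = cantor_map lam (d 0) y"
      unfolding x y_def cantor_map_def by (simp add: algebra_simps)
    moreover have "d 0 \<in> {0, 1}" using d by simp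
    ultimately show "x \<in> ?R" using y by auto
  qed
  have "cantor_map lam c y \<in> ?C" if "y \<in> ?C" and c: "c \<in> {0, 1}" for c y
  proof -
    obtain d where d: "\<forall>i. d i \<in> {0, 1::real}" and y: "y = (1 - lam) * (\<Sum>i. d i * lam ^ i)"
      using \<open>y \<in> ?C\<close> unfolding cantor_set_def by blast
    define e where "e = case_nat c d"
    have e: "\<forall>i. e i \<in> {0, 1}" using d c unfolding e_def by (auto split: nat.split)
    have "(\<Sum>i. e i * lam ^ i) = c + (\<Sum>i. lam * (d i * lam ^ i))"
      using suminf_split_head[OF summable_digits[OF assms e]] by (simp add: e_def mult_ac)
    also have "\<dots> = c + lam * (\<Sum>i. d i * lam ^ i)"
      using suminf_mult[OF summable_digits[OF assms d]] by simp
    finally have "cantor_map lam c y = (1 - lam) * (\<Sum>i. e i * lam ^ i)"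
      unfolding y cantor_map_def by (simp add: algebra_simps)
    then show ?thesis unfolding cantor_set_def using e by blast
  qed
  then show "?R \<subseteq> ?C" by auto
qed

lemma compact_cantor_set:
  assumes "0 < lam" "lam < 1/2"
  shows "compact (cantor_set lam)"
proof -
  define D :: "(nat \<Rightarrow> real) set" where "D = (\<Pi>\<^sub>E i\<in>UNIV. {0, 1})"
  have "compactin (product_topology (\<lambda>i::nat. euclideanreal) UNIV) D"
    unfolding D_def by (subst compactin_PiE) (auto simp: finite_imp_compact)
  then have D: "compact D" by (simp add: euclidean_product_topology)
  have M: "norm (d n * lam ^ n) \<le> lam ^ n" if "d \<in> D" for n d
  proof -
    have "d n \<in> {0, 1}" using that unfolding D_def by (auto simp: PiE_iff)
    then show ?thesis using assms by auto
  qed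
  have "uniform_limit D (\<lambda>n d. \<Sum>i<n. d i * lam ^ i) (\<lambda>d. \<Sum>i. d i * lam ^ i) sequentially"
    using assms by (intro Weierstrass_m_test[OF M] summable_geometric) auto
  moreover have "continuous_on D (\<lambda>d. \<Sum>i<n. d i * lam ^ i)" for n
    by (intro continuous_intros continuous_on_subset[OF continuous_on_product_coordinates]) auto
  ultimately have "continuous_on D (\<lambda>d. \<Sum>i. d i * lam ^ i)"
    by (intro uniform_limit_theorem[where F = sequentially]) auto
  then have "continuous_on D (\<lambda>d. (1 - lam) * (\<Sum>i. d i * lam ^ i))"
    by (intro continuous_intros)
  moreover have "cantor_set lam = (\<lambda>d. (1 - lam) * (\<Sum>i. d i * lam ^ i)) ` D"
    unfolding cantor_set_def D_def by (auto simp: PiE_iff image_iff)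
  ultimately show ?thesis using compact_continuous_image[OF _ D] by metis
qed

text \<open>The digit description is the attractor of the two similarities.\<close>

lemma cantor_set_unique_attractor:
  assumes "0 < lam" "lam < 1/2"
  shows "K = cantor_set lam \<longleftrightarrow>
    compact K \<and> K \<noteq> {} \<and> K = cantor_map lam 0 ` K \<union> cantor_map lam 1 ` K"
proof
  assume "K = cantor_set lam"
  moreover have "cantor_set lam \<noteq> {}" unfolding cantor_set_def by (auto intro!: exI[of _ "\<lambda>_. 0"])
  ultimately show "compact K \<and> K \<noteq> {} \<and> K = cantor_map lam 0 ` K \<union> cantor_map lam 1 ` K"
    using compact_cantor_set[OF assms] cantor_set_self_similar[OF assms] by simp
next
  assume "compact K \<and> K \<noteq> {} \<and> K = cantor_map lam 0 ` K \<union> cantor_map lam 1 ` K"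
  then have K: "compact K" "K \<noteq> {}" and eq: "K = cantor_map lam 0 ` K \<union> cantor_map lam 1 ` K"
    by blast+
  have mapK: "cantor_map lam c u \<in> K" if "c \<in> {0, 1}" "u \<in> K" for c u
    by (subst eq) (use that in auto)
  obtain B where B: "\<And>x. x \<in> K \<Longrightarrow> norm x \<le> B"
    using compact_imp_bounded[OF K(1)] unfolding bounded_iff by blast
  have pow0: "(\<lambda>n. lam ^ n * z n) \<longlonglongrightarrow> 0" if "\<And>n. z n \<in> K" for z :: "nat \<Rightarrow> real"
  proof (rule Lim_null_comparison)
    show "\<forall>\<^sub>F n in sequentially. norm (lam ^ n * z n) \<le> lam ^ n * B"
      using B[OF that] assms by (auto simp: abs_mult intro!: always_eventually mult_left_mono)
    show "(\<lambda>n. lam ^ n * B) \<longlonglongrightarrow> 0"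
      using assms by (intro tendsto_mult_left_zero LIMSEQ_power_zero) auto
  qed
  have lim: "(\<lambda>n. (1 - lam) * (\<Sum>i<n. d i * lam ^ i) + lam ^ n * z n)
      \<longlonglongrightarrow> (1 - lam) * (\<Sum>i. d i * lam ^ i)"
    if "\<forall>i. d i \<in> {0, 1}" "\<And>n. z n \<in> K" for d z :: "nat \<Rightarrow> real"
  proof -
    have "(\<lambda>n. (1 - lam) * (\<Sum>i<n. d i * lam ^ i) + lam ^ n * z n)
      \<longlonglongrightarrow> (1 - lam) * (\<Sum>i. d i * lam ^ i) + 0"
      by (intro tendsto_add tendsto_mult_left pow0 that summable_LIMSEQ summable_digits assms)
    then show ?thesis by simp
  qed
  show "K = cantor_set lam"
  proof
    show "K \<subseteq> cantor_set lam"
    proof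
      fix x assume x: "x \<in> K"
      have "\<forall>y\<in>K. \<exists>c y'. c \<in> {0, 1} \<and> y' \<in> K \<and> y = cantor_map lam c y'" using eq by blast
      then obtain c g where cg: "\<And>y. y \<in> K \<Longrightarrow> c y \<in> {0, 1} \<and> g y \<in> K \<and> y = cantor_map lam (c y) (g y)"
        by metis
      define z where "z n = (g ^^ n) x" for n
      define d where "d n = c (z n)" for n
      have z: "z n \<in> K" for n unfolding z_def by (induction n) (use x cg in auto)
      have d: "\<forall>i. d i \<in> {0, 1}" using cg z unfolding d_def by blast
      have step: "z n = lam * z (Suc n) + d n * (1 - lam)" for n
        using cg[OF z[of n]] unfolding cantor_map_def d_def z_def by simp
      have part: "x = (1 - lam) * (\<Sum>i<n. d i * lam ^ i) + lam ^ n * z n" for n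
      proof (induction n)
        case 0 then show ?case by (simp add: z_def)
      next
        case (Suc n)
        have "lam ^ n * z n = lam ^ n * (lam * z (Suc n) + d n * (1 - lam))"
          using step[of n] by simp
        with Suc show ?case by (simp add: algebra_simps)
      qed
      have "(\<lambda>n. x) \<longlonglongrightarrow> (1 - lam) * (\<Sum>i. d i * lam ^ i)"
        using lim[OF d z, of "\<lambda>n. n"] by (simp only: part[symmetric])
      then have "x = (1 - lam) * (\<Sum>i. d i * lam ^ i)" by (simp add: LIMSEQ_const_iff)
      then show "x \<in> cantor_set lam" using d unfolding cantor_set_def by blast
    qed
    show "cantor_set lam \<subseteq> K"
    proof
      fix x assume "x \<in> cantor_set lam"
      then obtain d where d: "\<forall>i. d i \<in> {0, 1::real}" and x: "x = (1 - lam) * (\<Sum>i. d i * lam ^ i)"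
        unfolding cantor_set_def by blast
      obtain w where w: "w \<in> K" using K(2) by blast
      have inK: "(1 - lam) * (\<Sum>i<n. e i * lam ^ i) + lam ^ n * u \<in> K"
        if "\<forall>i. e i \<in> {0, 1}" "u \<in> K" for e :: "nat \<Rightarrow> real" and u n
        using that(2)
      proof (induction n arbitrary: u)
        case 0 then show ?case by simp
      next
        case (Suc n)
        have "e n \<in> {0, 1}" using that(1) by blast
        then have "cantor_map lam (e n) u \<in> K" using mapK Suc.prems by blast
        from Suc.IH[OF this] show ?case
          by (simp add: cantor_map_def algebra_simps)
      qed
      show "x \<in> K" unfolding x
        by (rule closed_sequentially[OF compact_imp_closed[OF K(1)] _ lim[OF d, of "\<lambda>_. w"]])
          (use inK[OF d w] w in auto)
    qed
  qed
qed

end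

theory Submission
  imports Defs
begin

text \<open>
  Write \<open>\<epsilon> = 1 - 2 * lam\<close>. For \<open>lam \<ge> lambda_root k\<close> the defining equation gives
  \<open>k * \<epsilon> \<le> 1/2\<close>. Take level-\<open>n\<close> intervals \<open>[a, a + s]\<close> and \<open>[b, b + s]\<close> contained in
  \<open>[1 - lam, 1]\<close>. Replacing each by its two children gives four boxes LL, LR, RL, RR, and
  Bernoulli's inequality shows that the images of consecutive boxes under \<open>x ^ k * y\<close> overlap.
  Hence every \<open>t\<close> in the image of the box \<open>[1 - lam, 1]\<^sup>2\<close> can be followed down through the levels,
  and compactness yields a point of the product of Cantor sets that is mapped to \<open>t\<close>.
  This covers \<open>[lam, 1]\<close>, and the self-similarity \<open>y \<mapsto> lam * y\<close> extends it to \<open>(0, 1]\<close>.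
\<close>

section \<open>Overlap of the images of consecutive child boxes\<close>

text \<open>Serves LL to LR and RL to RR, with \<open>x\<close> the left end of the common first
  interval. By Bernoulli, enlarging \<open>x\<close> by \<open>lam * s\<close> multiplies the power
  by at least \<open>1 + k * lam * s / x\<close>. Since \<open>b + lam * s >= 1/2\<close>,
  \<open>k >= 2\<close> and \<open>x <= 1\<close>, this gains at least \<open>lam * s\<close> in the
  second factor, and \<open>lam >= 1/3\<close> makes that at least the gap
  \<open>(1 - 2 * lam) * s\<close>.\<close>

lemma power_mult_gap_y:
  fixes x b lam s :: real
  assumes k: "k \<ge> 2" and lam: "1/3 \<le> lam" "lam < 1/2" and x: "0 < x" "x \<le> 1"
    and b: "1 - lam \<le> b" and s: "0 \<le> s"
  shows "x ^ k * (b + (1 - lam) * s) \<le> (x + lam * s) ^ k * (b + lam * s)"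
proof -
  have ls: "0 \<le> lam * s" using lam s by simp
  have "1 + real k * (lam * s / x) \<le> (1 + lam * s / x) ^ k"
    using divide_nonneg_pos[OF ls x(1)] by (intro Bernoulli_inequality) linarith
  then have "x ^ k * (1 + real k * (lam * s / x)) \<le> x ^ k * (1 + lam * s / x) ^ k"
    using x by (intro mult_left_mono) auto
  also have "\<dots> = (x + lam * s) ^ k"
    using x by (simp add: power_mult_distrib[symmetric] field_simps)
  finally have bern: "x ^ k * (1 + real k * (lam * s / x)) \<le> (x + lam * s) ^ k" .
  have "1/2 \<le> b + lam * s" using b lam(2) ls by linarith
  then have pos: "1 \<le> 2 * (b + lam * s)" "0 \<le> b + lam * s" by auto
  have "1 * s \<le> 2 * (b + lam * s) * s" using pos(1) s by (rule mult_right_mono)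
  also have "\<dots> \<le> real k * (b + lam * s) * s"
    using k by (intro mult_right_mono pos(2) s) auto
  also have "s \<le> s / x" using s x by (simp add: field_simps mult_left_le)
  then have "real k * (b + lam * s) * s \<le> real k * (b + lam * s) * (s / x)"
    using pos(2) by (intro mult_left_mono) auto
  finally have "s \<le> real k * (b + lam * s) * (s / x)" by simp
  then have "lam * s \<le> lam * (real k * (b + lam * s) * (s / x))"
    using lam by (intro mult_left_mono) auto
  moreover have "(1 - 2 * lam) * s \<le> lam * s" using lam s by (intro mult_right_mono) auto
  ultimately have "b + (1 - lam) * s \<le> (1 + real k * (lam * s / x)) * (b + lam * s)"
    by (simp add: algebra_simps add_divide_distrib)
  then have "x ^ k * (b + (1 - lam) * s) \<le> x ^ k * ((1 + real k * (lam * s / x)) * (b + lam * s))"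
    using x by (intro mult_left_mono) auto
  also have "\<dots> = x ^ k * (1 + real k * (lam * s / x)) * (b + lam * s)" by simp
  also have "\<dots> \<le> (x + lam * s) ^ k * (b + lam * s)"
    using bern pos(2) by (rule mult_right_mono)
  finally show ?thesis .
qed

text \<open>Serves LR to RL. Crossing the gap in the first coordinate lowers \<open>z\<close> by the
  relative amount \<open>u\<close>, hence \<open>z ^ k\<close> by a factor of at least
  \<open>1 - k * u\<close>. As \<open>z >= 1/2\<close>, the hypothesis on \<open>k\<close> gives
  \<open>k * u <= s\<close>, and \<open>b + s <= 1\<close> then makes the gain \<open>s\<close> in
  the second coordinate outweigh the loss.\<close>

lemma power_mult_gap_x:
  fixes a b lam s :: real
  assumes eps: "real k * (1 - 2 * lam) \<le> 1/2" and lam: "0 < lam" "lam < 1/2"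
    and a: "1 - lam \<le> a" and b: "0 \<le> b" "b + s \<le> 1" and s: "0 \<le> s"
  shows "(a + (1 - lam) * s) ^ k * b \<le> (a + lam * s) ^ k * (b + s)"
proof -
  define z where "z = a + (1 - lam) * s"
  define u where "u = (1 - 2 * lam) * s / z"
  have "0 \<le> (1 - lam) * s" using lam s by simp
  then have z: "z \<ge> 1/2" using a lam unfolding z_def by linarith
  \<comment> \<open>Ensures \<open>u <= 1\<close>, the condition for Bernoulli's inequality at
    \<open>- u\<close>.\<close>
  have zs: "(1 - 2 * lam) * s \<le> z"
  proof -
    have "0 \<le> lam * s" using lam s by simp
    moreover have "z - (1 - 2 * lam) * s = a + lam * s" unfolding z_def by (simp add: algebra_simps)
    ultimately show ?thesis using a lam by linarith
  qed
  have u1: "u \<le> 1" using zs z unfolding u_def by simp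
  have "real k * u = real k * (1 - 2 * lam) * s / z" unfolding u_def by simp
  also have "\<dots> \<le> (1/2 * s) / z"
    using eps s z by (intro divide_right_mono mult_right_mono) auto
  also have "\<dots> \<le> s" using z s mult_right_mono[of "1/2" z s] by (simp add: field_simps)
  finally have ku: "real k * u \<le> s" .
  have "0 \<le> u" using lam s z unfolding u_def by simp
  then have "real k * u * (b + s) \<le> real k * u" using b s by (intro mult_left_le) auto
  with ku have "b \<le> (1 - real k * u) * (b + s)" by (simp add: algebra_simps)
  also have "\<dots> \<le> (1 - u) ^ k * (b + s)"
    using Bernoulli_inequality[of "- u" k] u1 b s by (intro mult_right_mono) auto
  finally have "z ^ k * b \<le> z ^ k * ((1 - u) ^ k * (b + s))"
    using z by (intro mult_left_mono) auto
  also have "\<dots> = (z * (1 - u)) ^ k * (b + s)" by (simp add: power_mult_distrib)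
  also have "z * (1 - u) = a + lam * s"
    using z unfolding u_def by (simp add: field_simps) (simp add: z_def algebra_simps)
  finally show ?thesis unfolding z_def .
qed

section \<open>The Cantor set and its cells\<close>

lemma cantor_set_scale:
  assumes "0 < lam" "lam < 1/2" "x \<in> cantor_set lam"
  shows "lam * x \<in> cantor_set lam" "1 - lam + lam * x \<in> cantor_set lam"
proof -
  have "cantor_map lam 0 x \<in> cantor_set lam" "cantor_map lam 1 x \<in> cantor_set lam"
    using cantor_set_self_similar[OF assms(1,2)] assms(3) by blast+
  then show "lam * x \<in> cantor_set lam" "1 - lam + lam * x \<in> cantor_set lam"
    by (simp_all add: cantor_map_def add.commute)
qed

lemma zero_in_cantor_set: "0 \<in> cantor_set lam"
  unfolding cantor_set_def by (auto intro!: exI[of _ "\<lambda>_. 0"])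

lemma cantor_set_subset_unit:
  assumes "0 < lam" "lam < 1/2"
  shows "cantor_set lam \<subseteq> {0..1}"
proof
  fix x assume "x \<in> cantor_set lam"
  then obtain d where d: "\<forall>i. d i \<in> {0, 1::real}" and x: "x = (1 - lam) * (\<Sum>i. d i * lam ^ i)"
    unfolding cantor_set_def by blast
  have s: "summable (\<lambda>i. d i * lam ^ i)" using summable_digits[OF assms d] .
  have di: "0 \<le> d i \<and> d i \<le> 1" for i using d[rule_format, of i] by auto
  have nonneg: "0 \<le> (\<Sum>i. d i * lam ^ i)"
    using di assms by (intro suminf_nonneg s) auto
  have "(\<Sum>i. d i * lam ^ i) \<le> (\<Sum>i. lam ^ i)"
    using di assms by (intro suminf_le s summable_geometric) (auto intro: mult_left_le_one_le)
  also have "\<dots> = 1 / (1 - lam)" using assms by (intro suminf_geometric) auto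
  finally have "x \<le> (1 - lam) * (1 / (1 - lam))"
    using assms unfolding x by (intro mult_left_mono) auto
  then show "x \<in> {0..1}" using nonneg assms unfolding x by auto
qed

text \<open>The condition on \<open>a + s * x\<close> stands in for \<open>[a, a + s]\<close> being a construction interval of the
  Cantor set, so that no addressing of intervals by digit strings is needed.\<close>

definition cantor_cell :: "real \<Rightarrow> real \<Rightarrow> real set" where
  "cantor_cell lam s =
     {a. 1 - lam \<le> a \<and> a + s \<le> 1 \<and> (\<forall>x\<in>cantor_set lam. a + s * x \<in> cantor_set lam)}"

lemma cantor_cell_children:
  assumes "0 < lam" "lam < 1/2" "0 \<le> s" "a \<in> cantor_cell lam s"
  shows "a \<in> cantor_cell lam (lam * s)" "a + (1 - lam) * s \<in> cantor_cell lam (lam * s)"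
proof -
  have a: "1 - lam \<le> a" "a + s \<le> 1" "\<And>x. x \<in> cantor_set lam \<Longrightarrow> a + s * x \<in> cantor_set lam"
    using assms(4) unfolding cantor_cell_def by auto
  have "lam * s \<le> s" "0 \<le> (1 - lam) * s" using assms by (auto intro: mult_left_le_one_le)
  moreover have "a + lam * s * x \<in> cantor_set lam" if "x \<in> cantor_set lam" for x
    using a(3)[OF cantor_set_scale(1)[OF assms(1,2) that]] by (simp add: mult_ac)
  moreover have "a + (1 - lam) * s + lam * s * x \<in> cantor_set lam" if "x \<in> cantor_set lam" for x
    using a(3)[OF cantor_set_scale(2)[OF assms(1,2) that]] by (simp add: algebra_simps)
  ultimately show "a \<in> cantor_cell lam (lam * s)" "a + (1 - lam) * s \<in> cantor_cell lam (lam * s)"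
    using a(1,2) unfolding cantor_cell_def by (auto simp: algebra_simps)
qed

section \<open>Covering the unit interval by nested boxes\<close>

lemma cantor_cell_refine:
  assumes k: "k \<ge> 2" and lam: "lam < 1/2" and eps: "real k * (1 - 2 * lam) \<le> 1/2"
    and s: "0 \<le> s" and a: "a \<in> cantor_cell lam s" and b: "b \<in> cantor_cell lam s"
    and t: "a ^ k * b \<le> t" "t \<le> (a + s) ^ k * (b + s)"
  shows "\<exists>a'\<in>cantor_cell lam (lam * s). \<exists>b'\<in>cantor_cell lam (lam * s).
           a' ^ k * b' \<le> t \<and> t \<le> (a' + lam * s) ^ k * (b' + lam * s)"
proof -
  \<comment> \<open>With \<open>k >= 2\<close> the hypothesis yields \<open>lam >= 3/8\<close>, more
    than the \<open>1/3\<close> asked for by \<open>power_mult_gap_y\<close>.\<close>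
  have "2 * (1 - 2 * lam) \<le> real k * (1 - 2 * lam)"
    using k lam by (intro mult_right_mono) auto
  then have lam0: "1/3 \<le> lam" "0 < lam" using eps by auto
  note child = cantor_cell_children[OF lam0(2) lam s]
  have ab: "1 - lam \<le> a" "1 - lam \<le> b" "a + s \<le> 1" "b + s \<le> 1"
    using a b unfolding cantor_cell_def by auto
  let ?a = "a + (1 - lam) * s" and ?b = "b + (1 - lam) * s"
  have eq: "?a + lam * s = a + s" "?b + lam * s = b + s" by (auto simp: algebra_simps)
  have "0 \<le> (1 - lam) * s" "0 \<le> lam * s" using lam lam0 s by auto
  then have a': "0 < ?a" "?a \<le> 1" using ab lam eq by linarith+
  have gap1: "a ^ k * ?b \<le> (a + lam * s) ^ k * (b + lam * s)"
    using ab lam s by (intro power_mult_gap_y k lam0 lam) auto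
  have gap2: "?a ^ k * b \<le> (a + lam * s) ^ k * (b + s)"
    using ab lam s by (intro power_mult_gap_x eps lam0 lam) auto
  have gap3: "?a ^ k * ?b \<le> (a + s) ^ k * (b + lam * s)"
    using power_mult_gap_y[OF k lam0(1) lam a' ab(2) s] by (simp only: eq)
  \<comment> \<open>The cases are LL, LR, RL, RR. The lower end for LL and the upper end for RR are
    those of the parent box, so only the three overlaps are needed.\<close>
  consider "t \<le> (a + lam * s) ^ k * (b + lam * s)"
    | "a ^ k * ?b \<le> t" "t \<le> (a + lam * s) ^ k * (b + s)"
    | "?a ^ k * b \<le> t" "t \<le> (a + s) ^ k * (b + lam * s)"
    | "?a ^ k * ?b \<le> t"
    using gap1 gap2 gap3 by linarith
  then show ?thesis
  proof cases
    case 1 then show ?thesis using t child(1)[OF a] child(1)[OF b] by blast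
  next
    case 2 then show ?thesis using child(1)[OF a] child(2)[OF b] eq(2) by metis
  next
    case 3 then show ?thesis using child(2)[OF a] child(1)[OF b] eq(1) by metis
  next
    case 4 then show ?thesis using t child(2)[OF a] child(2)[OF b] eq by metis
  qed
qed

lemma power_mult_covers_top:
  assumes k: "k \<ge> 2" and lam: "lam < 1/2" and eps: "real k * (1 - 2 * lam) \<le> 1/2"
    and t: "(1 - lam) ^ Suc k \<le> t" "t \<le> 1"
  shows "\<exists>x\<in>cantor_set lam. \<exists>y\<in>cantor_set lam. t = x ^ k * y"
proof -
  have "2 * (1 - 2 * lam) \<le> real k * (1 - 2 * lam)"
    using k lam by (intro mult_right_mono) auto
  then have lam0: "0 < lam" using eps by auto
  have "\<exists>a\<in>cantor_cell lam (lam ^ Suc n). \<exists>b\<in>cantor_cell lam (lam ^ Suc n).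
          a ^ k * b \<le> t \<and> t \<le> (a + lam ^ Suc n) ^ k * (b + lam ^ Suc n)" for n
  proof (induction n)
    case 0
    \<comment> \<open>The starting box has side \<open>lam\<close>, not 1, which is why level
      \<open>n\<close> carries \<open>lam ^ Suc n\<close>.\<close>
    have "1 - lam \<in> cantor_cell lam lam"
      using cantor_set_scale(2)[OF lam0 lam] unfolding cantor_cell_def by auto
    then show ?case using t by (intro bexI[of _ "1 - lam"]) (auto simp: mult.commute)
  next
    case (Suc n)
    then show ?case using cantor_cell_refine[OF k lam eps, of "lam ^ Suc n"] lam0
      by (metis order_less_imp_le power_Suc zero_less_power)
  qed
  then obtain a b where a: "\<And>n. a n \<in> cantor_cell lam (lam ^ Suc n)"
    and b: "\<And>n. b n \<in> cantor_cell lam (lam ^ Suc n)"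
    and lo: "\<And>n. a n ^ k * b n \<le> t"
    and hi: "\<And>n. t \<le> (a n + lam ^ Suc n) ^ k * (b n + lam ^ Suc n)"
    by metis
  \<comment> \<open>Left endpoints of cells lie in the Cantor set: put \<open>x = 0\<close> in the
    cell condition.\<close>
  have cell: "c \<in> cantor_set lam" if "c \<in> cantor_cell lam s" for c s
    using that zero_in_cantor_set[of lam] unfolding cantor_cell_def by force
  have "seq_compact (cantor_set lam \<times> cantor_set lam)"
    by (intro compact_imp_seq_compact compact_Times compact_cantor_set lam0 lam)
  moreover have "\<forall>n. (a n, b n) \<in> cantor_set lam \<times> cantor_set lam"
    using a b cell by blast
  ultimately obtain l r where l: "l \<in> cantor_set lam \<times> cantor_set lam"
    and r: "strict_mono (r :: nat \<Rightarrow> nat)" and lim: "((\<lambda>n. (a n, b n)) \<circ> r) \<longlonglongrightarrow> l"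
    by (rule seq_compactE[where f = "\<lambda>n. (a n, b n)"]) blast+
  obtain x y where xy: "l = (x, y)" by (cases l)
  have limx: "(\<lambda>n. a (r n)) \<longlonglongrightarrow> x" and limy: "(\<lambda>n. b (r n)) \<longlonglongrightarrow> y"
    using tendsto_fst[OF lim] tendsto_snd[OF lim] by (simp_all add: xy o_def)
  have "(\<lambda>n. lam ^ Suc n) \<longlonglongrightarrow> 0"
    using lam lam0 by (intro LIMSEQ_Suc LIMSEQ_power_zero) auto
  from LIMSEQ_subseq_LIMSEQ[OF this r] have lims: "(\<lambda>n. lam ^ Suc (r n)) \<longlonglongrightarrow> 0"
    by (simp add: o_def)
  \<comment> \<open>The side lengths tend to 0, so both corners of the boxes converge to
    \<open>(x, y)\<close> and \<open>t\<close> is squeezed.\<close>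
  have "(\<lambda>n. a (r n) ^ k * b (r n)) \<longlonglongrightarrow> x ^ k * y"
    by (intro tendsto_intros limx limy)
  then have "x ^ k * y \<le> t" by (rule LIMSEQ_le_const2) (use lo in blast)
  moreover have "(\<lambda>n. (a (r n) + lam ^ Suc (r n)) ^ k * (b (r n) + lam ^ Suc (r n)))
      \<longlonglongrightarrow> (x + 0) ^ k * (y + 0)"
    by (intro tendsto_mult tendsto_power tendsto_add limx limy lims)
  then have "t \<le> (x + 0) ^ k * (y + 0)" by (rule LIMSEQ_le_const) (use hi in blast)
  ultimately have "t = x ^ k * y" by simp
  then show ?thesis using l xy by blast
qed

lemma power_mult_cantor_set_eq:
  assumes k: "k \<ge> 2" and lam: "lam < 1/2" and eps: "real k * (1 - 2 * lam) \<le> 1/2"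
  shows "{x ^ k * y | x y. x \<in> cantor_set lam \<and> y \<in> cantor_set lam} = {0..1}" (is "?P = _")
proof
  have "2 * (1 - 2 * lam) \<le> real k * (1 - 2 * lam)"
    using k lam by (intro mult_right_mono) auto
  then have lam0: "3/8 \<le> lam" "0 < lam" using eps by auto
  have unit: "0 \<le> x \<and> x \<le> 1" if "x \<in> cantor_set lam" for x
    using cantor_set_subset_unit[OF lam0(2) lam] that by auto
  show "?P \<subseteq> {0..1}"
    by (auto intro!: mult_le_one power_le_one mult_nonneg_nonneg zero_le_power dest!: unit)
  have scale: "lam * t \<in> ?P" if t: "t \<in> ?P" for t
  proof -
    obtain x y where "x \<in> cantor_set lam" "y \<in> cantor_set lam" "t = x ^ k * y"
      using t by blast
    then show ?thesis using cantor_set_scale(1)[OF lam0(2) lam, of y]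
      by (intro CollectI exI[of _ x] exI[of _ "lam * y"]) auto
  qed
  \<comment> \<open>The top box reaches down to \<open>lam\<close>, because
    \<open>(5/8) ^ 3 = 125/512 < 3/8\<close>.\<close>
  have "(1 - lam) ^ Suc k \<le> (1 - lam) ^ 3" using k lam lam0 by (intro power_decreasing) auto
  also have "\<dots> \<le> (5/8) ^ 3" using lam lam0 by (intro power_mono) auto
  also have "\<dots> \<le> lam" using lam0 by (simp add: power3_eq_cube)
  finally have top: "t \<in> ?P" if "lam \<le> t" "t \<le> 1" for t
    using power_mult_covers_top[OF k lam eps, of t] that by fastforce
  have pos: "t \<in> ?P" if "lam ^ Suc n \<le> t" "t \<le> 1" for n t
    using that
  proof (induction n arbitrary: t)
    case 0
    then show ?case using top by simp
  next
    case (Suc n)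
    show ?case
    proof (cases "lam \<le> t")
      case True
      then show ?thesis using top Suc.prems by blast
    next
      case False
      \<comment> \<open>As \<open>t < lam\<close>, the quotient stays below 1 and lies one scale
        higher.\<close>
      then have "t / lam \<in> ?P" using Suc.prems lam0 by (intro Suc.IH) (auto simp: field_simps)
      from scale[OF this] show ?thesis using lam0 by simp
    qed
  qed
  show "{0..1} \<subseteq> ?P"
  proof
    fix t :: real assume t: "t \<in> {0..1}"
    show "t \<in> ?P"
    proof (cases "t = 0")
      case True
      then show ?thesis using zero_in_cantor_set[of lam] k
        by (intro CollectI exI[of _ 0]) auto
    next
      case False
      then obtain n where "lam ^ n < t" using t lam real_arch_pow_inv[of t lam] by auto
      moreover have "lam ^ Suc n \<le> lam ^ n" using lam lam0 by (intro power_decreasing) auto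
      ultimately show ?thesis using pos[of n t] t by simp
    qed
  qed
qed

section \<open>The roots and their limit\<close>

definition lambda_poly :: "nat \<Rightarrow> real \<Rightarrow> real" where
  "lambda_poly k x = (real k - 1) * x ^ k + (2 * real k + 2) * x - real k - 1"

lemma lambda_poly_strict_mono:
  assumes "k \<ge> 2" "0 \<le> x" "x < y"
  shows "lambda_poly k x < lambda_poly k y"
proof -
  have "(real k - 1) * x ^ k \<le> (real k - 1) * y ^ k"
    using assms by (intro mult_left_mono power_mono) auto
  moreover have "(2 * real k + 2) * x < (2 * real k + 2) * y"
    using assms by (intro mult_strict_left_mono) auto
  ultimately show ?thesis unfolding lambda_poly_def by linarith
qed

text \<open>The polynomial is strictly increasing on the nonnegative reals, equals
  \<open>- (k + 1)\<close> at 0 and is positive at \<open>1/2\<close>.\<close>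

lemma lambda_root_properties:
  assumes k: "k \<ge> 2"
  shows "\<exists>!x. is_lambda_root k x" and "0 < lambda_root k" and "lambda_root k < 1/2"
    and "lambda_poly k (lambda_root k) = 0"
proof -
  have "0 < (real k - 1) * (1/2) ^ k" using k by (intro mult_pos_pos) auto
  then have half: "0 < lambda_poly k (1/2)" unfolding lambda_poly_def by (simp add: field_simps)
  have zero: "lambda_poly k 0 < 0" using k unfolding lambda_poly_def by (simp add: power_0_left)
  have "continuous_on {0..1/2} (lambda_poly k)"
    unfolding lambda_poly_def by (intro continuous_intros)
  then obtain x where x: "0 \<le> x" "x \<le> 1/2" "lambda_poly k x = 0"
    using IVT'[of "lambda_poly k" 0 0 "1/2"] half zero by auto
  then have xb: "0 < x" "x < 1/2" using half zero by (metis less_irrefl order_le_less)+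
  have root: "is_lambda_root k x" using x xb unfolding is_lambda_root_def lambda_poly_def by simp
  have uniq: "z = x" if "is_lambda_root k z" for z
  proof -
    have "0 < z" "lambda_poly k z = 0"
      using that unfolding is_lambda_root_def lambda_poly_def by auto
    then show ?thesis
      using lambda_poly_strict_mono[OF k, of z x] lambda_poly_strict_mono[OF k, of x z] x
      by (cases z x rule: linorder_cases) auto
  qed
  show "\<exists>!x. is_lambda_root k x" using root uniq by blast
  have "lambda_root k = x" unfolding lambda_root_def using root uniq by (rule the_equality)
  then show "0 < lambda_root k" "lambda_root k < 1/2" "lambda_poly k (lambda_root k) = 0"
    using x xb by auto
qed

text \<open>The polynomial is nonnegative from its root onwards; rearrange and use
  \<open>lam < 1/2\<close> in the power. This feeds both the covering hypothesis and, at
  \<open>lam = lambda_root k\<close>, the limit.\<close>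

lemma lambda_root_eps_bound:
  assumes k: "k \<ge> 2" and lam: "lambda_root k \<le> lam" "lam < 1/2"
  shows "(real k + 1) * (1 - 2 * lam) \<le> (real k - 1) * (1/2) ^ k"
proof -
  note r = lambda_root_properties(2-4)[OF k]
  have "0 \<le> lambda_poly k lam"
    using r lam lambda_poly_strict_mono[OF k, of "lambda_root k" lam]
    by (cases "lambda_root k = lam") auto
  then have "(real k + 1) * (1 - 2 * lam) \<le> (real k - 1) * lam ^ k"
    unfolding lambda_poly_def by (simp add: algebra_simps)
  also have "\<dots> \<le> (real k - 1) * (1/2) ^ k"
    using k lam r by (intro mult_left_mono power_mono) auto
  finally show ?thesis .
qed

lemma lambda_root_eps_half:
  assumes k: "k \<ge> 2" and lam: "lambda_root k \<le> lam" "lam < 1/2"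
  shows "real k * (1 - 2 * lam) \<le> 1/2"
proof -
  have pow: "2 * (real k - 1) \<le> 2 ^ k"
    using k
  proof (induction k rule: dec_induct)
    case (step n)
    then show ?case using power_increasing[of 1 n "2::real"] by simp
  qed simp
  have "real k * (1 - 2 * lam) \<le> (real k + 1) * (1 - 2 * lam)"
    using lam by (intro mult_right_mono) auto
  also have "\<dots> \<le> (real k - 1) * (1/2) ^ k" using lambda_root_eps_bound[OF assms] .
  also have "\<dots> \<le> 1/2" using pow by (simp add: power_one_over field_simps)
  finally show ?thesis .
qed

text \<open>It suffices that the next polynomial is negative at \<open>x\<close>. Eliminating
  \<open>1 - 2 * x\<close> by the root equation reduces this to
  \<open>(k + 1) * k * x < (k + 2) * (k - 1)\<close>, which follows from \<open>x < 1/2\<close> and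
  \<open>k * k >= 4\<close>.\<close>

lemma lambda_root_less_Suc:
  assumes k: "k \<ge> 2"
  shows "lambda_root k < lambda_root (Suc k)"
proof -
  define x where "x = lambda_root k"
  have x: "0 < x" "x < 1/2" "lambda_poly k x = 0"
    using lambda_root_properties[OF k] unfolding x_def by auto
  have root: "(real k + 1) * (1 - 2 * x) = (real k - 1) * x ^ k"
    using x(3) unfolding lambda_poly_def by (simp add: algebra_simps)
  have "2 * 2 \<le> real k * real k" using k by (intro mult_mono) auto
  then have kk: "(real k + 1) * real k * (1/2) \<le> (real k + 2) * (real k - 1)"
    using k by (simp add: algebra_simps)
  have "(real k + 1) * (real k * x) < (real k + 1) * (real k * (1/2))"
    using x k by (intro mult_strict_left_mono) auto
  also have "\<dots> \<le> (real k + 2) * (real k - 1)" using kk by simp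
  finally have "(real k + 1) * (real k * x) * x ^ k < (real k + 2) * (real k - 1) * x ^ k"
    using x by (intro mult_strict_right_mono) auto
  also have "\<dots> = (real k + 1) * ((real k + 2) * (1 - 2 * x))"
    using root by (simp only: mult.assoc) (simp only: mult.left_commute[of "real k + 1"])
  finally have "(real k + 1) * (real k * x ^ Suc k) < (real k + 1) * ((real k + 2) * (1 - 2 * x))"
    by (simp add: mult_ac)
  then have "real k * x ^ Suc k < (real k + 2) * (1 - 2 * x)"
    by (rule mult_left_less_imp_less) simp
  then have neg: "lambda_poly (Suc k) x < 0" unfolding lambda_poly_def by (simp add: algebra_simps)
  have r: "0 < lambda_root (Suc k)" "lambda_poly (Suc k) (lambda_root (Suc k)) = 0"
    using lambda_root_properties[of "Suc k"] k by auto
  show ?thesis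
    using neg r lambda_poly_strict_mono[of "Suc k" "lambda_root (Suc k)" x] k
    unfolding x_def by (cases x "lambda_root (Suc k)" rule: linorder_cases) (auto simp: x_def)
qed

lemma lambda_root_strict_mono: "strict_mono_on {2..} lambda_root"
proof (rule strict_mono_onI)
  fix m n :: nat assume "m \<in> {2..}" "n \<in> {2..}" "m < n"
  \<comment> \<open>The successor step is available only from 2 on, hence the shifted
    sequence.\<close>
  moreover have "strict_mono (\<lambda>n. lambda_root (n + 2))"
    unfolding strict_mono_Suc_iff using lambda_root_less_Suc by simp
  ultimately show "lambda_root m < lambda_root n"
    using strict_monoD[of "\<lambda>n. lambda_root (n + 2)" "m - 2" "n - 2"]
    by (simp del: add_2_eq_Suc')
qed

lemma lambda_root_tendsto: "lambda_root \<longlonglongrightarrow> 1/2"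
proof (rule real_tendsto_sandwich)
  have "1/2 - (1/2) ^ k \<le> lambda_root k" if k: "k \<ge> 2" for k
  proof -
    have "(real k + 1) * (1 - 2 * lambda_root k) \<le> (real k - 1) * (1/2) ^ k"
      using lambda_root_eps_bound[OF k order_refl lambda_root_properties(3)[OF k]] .
    \<comment> \<open>Loosening \<open>k - 1\<close> to \<open>k + 1\<close> lets the factor cancel,
      leaving a geometric error.\<close>
    also have "\<dots> \<le> (real k + 1) * (1/2) ^ k" by (intro mult_right_mono) auto
    finally have "1 - 2 * lambda_root k \<le> (1/2) ^ k"
      by (rule mult_left_le_imp_le) simp
    then show ?thesis using zero_le_power[of "1/2::real" k] by linarith
  qed
  then show "\<forall>\<^sub>F k in sequentially. 1/2 - (1/2) ^ k \<le> lambda_root k"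
    unfolding eventually_sequentially by blast
  show "\<forall>\<^sub>F k in sequentially. lambda_root k \<le> 1/2"
    unfolding eventually_sequentially using lambda_root_properties(3) by (meson less_imp_le)
  have "(\<lambda>k. 1/2 - (1/2) ^ k) \<longlonglongrightarrow> 1/2 - (0::real)"
    by (intro tendsto_diff tendsto_const LIMSEQ_power_zero) auto
  then show "(\<lambda>k. 1/2 - (1/2) ^ k) \<longlonglongrightarrow> (1/2::real)" by simp
qed (rule tendsto_const)

theorem theorem1p2:
  shows "(\<forall>k::nat. k \<ge> 2 \<longrightarrow>
            (\<exists>!x. is_lambda_root k x) \<and>
            0 < lambda_root k \<and> lambda_root k < 1/2 \<and>
            (\<forall>lam::real. lambda_root k \<le> lam \<and> lam < 1/2 \<longrightarrow>
               {x ^ k * y | x y. x \<in> cantor_set lam \<and> y \<in> cantor_set lam} = {0..1}))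
         \<and> strict_mono_on {2..} lambda_root
         \<and> lambda_root \<longlonglongrightarrow> 1/2"
proof (intro conjI allI impI lambda_root_strict_mono lambda_root_tendsto)
  fix k :: nat assume k: "k \<ge> 2"
  show "\<exists>!x. is_lambda_root k x" "0 < lambda_root k" "lambda_root k < 1/2"
    using lambda_root_properties[OF k] by blast+
  fix lam :: real assume lam: "lambda_root k \<le> lam \<and> lam < 1/2"
  then show "{x ^ k * y | x y. x \<in> cantor_set lam \<and> y \<in> cantor_set lam} = {0..1}"
    using power_mult_cantor_set_eq[OF k] lambda_root_eps_half[OF k] by blast
qed

end
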